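(* Let $\mathfrak{g}=\mathfrak{g}_{3.5}^0\oplus\mathfrak{g}_1$ be the four-dimensional real Lie algebra with basis $\mathcal{B}=\{e_1,e_2,e_3,e_4\}$ whose nonzero Lie brackets (up to skew-symmetry) are $[e_2,e_3]=e_1$, $[e_3,e_1]=e_2$. Let $\langle\cdot,\cdot\rangle$ be a pseudo-Riemannian inner product on $\mathfrak{g}$ and let $(R_{ij})$ be the matrix of its Ricci operator $\operatorname{Ric}$ in the basis $\mathcal{B}$. If $$R_{i1}=R_{i2}=0\ (i=3,4),\quad R_{i4}=0\ (i=1,2,3),\quad R_{21}=-R_{12},\quad R_{22}=R_{11},$$ then $\langle\cdot,\cdot\rangle$ is an algebraic Ricci soliton. With these conditions in place, $\operatorname{Ric}=\eta I_4+D$ where $\eta=R_{33}$ and $$D=\begin{bmatrix}R_{11}-R_{33}&R_{12}&R_{13}&0\\-R_{12}&R_{11}-R_{33}&R_{23}&0\\0&0&0&0\\0&0&R_{43}&R_{44}-R_{33}\end{bmatrix}$$ is (the matrix in the basis $\mathcal{B}$ of) a derivation of $\mathfrak{g}$.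
   Context: A pseudo-Riemannian inner product on a real Lie algebra $\mathfrak{g}$ is a nondegenerate symmetric bilinear form $\langle\cdot,\cdot\rangle$ on $\mathfrak{g}$ (of some signature $(r,s)$). Its Levi-Civita connection $\nabla$ is defined by $2\langle\nabla_uv,w\rangle=\langle[u,v],w\rangle+\langle[w,u],v\rangle+\langle[w,v],u\rangle$; its curvature is $R_{uv}=\nabla_{[u,v]}-[\nabla_u,\nabla_v]$; its Ricci curvature $\operatorname{ric}(u,v)$ is the trace of $w\mapsto R_{uw}v$; its Ricci operator $\operatorname{Ric}$ is the endomorphism of $\mathfrak{g}$ with $\langle\operatorname{Ric}(u),v\rangle=\operatorname{ric}(u,v)$. The matrix $(R_{ij})$ of $\operatorname{Ric}$ in a basis $\{e_i\}$ is given by $\operatorname{Ric}(e_j)=\sum_iR_{ij}e_i$ (the same column convention is used for $D$). A derivation is a linear map $D:\mathfrak{g}\to\mathfrak{g}$ with $D[x,y]=[D(x),y]+[x,D(y)]$ for all $x,y$. The inner product is an algebraic Ricci soliton if $\operatorname{Ric}=\eta\,\mathrm{Id}_{\mathfrak{g}}+D$ for some $\eta\in\mathbb{R}$ and some derivation $D$ of $\mathfrak{g}$. *)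

theory Defs
  imports "HOL-Analysis.Analysis"
begin

subsection \<open>Lie brackets and derivations\<close>

definition lie_bracket :: "('a::real_vector \<Rightarrow> 'a \<Rightarrow> 'a) \<Rightarrow> bool" where
  "lie_bracket br \<longleftrightarrow> bilinear br \<and> (\<forall>x. br x x = 0) \<and>
     (\<forall>x y z. br x (br y z) + br y (br z x) + br z (br x y) = 0)"

definition derivation :: "('a::real_vector \<Rightarrow> 'a \<Rightarrow> 'a) \<Rightarrow> ('a \<Rightarrow> 'a) \<Rightarrow> bool" where
  "derivation br D \<longleftrightarrow> linear D \<and> (\<forall>x y. D (br x y) = br (D x) y + br x (D y))"


subsection \<open>Pseudo-Riemannian inner products and their curvature\<close>

definition pseudo_inner :: "('a::real_vector \<Rightarrow> 'a \<Rightarrow> real) \<Rightarrow> bool" where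
  "pseudo_inner B \<longleftrightarrow> bilinear B \<and> (\<forall>x y. B x y = B y x) \<and>
     (\<forall>x. (\<forall>y. B x y = 0) \<longrightarrow> x = 0)"

definition levi_civita ::
  "('a::real_vector \<Rightarrow> 'a \<Rightarrow> 'a) \<Rightarrow> ('a \<Rightarrow> 'a \<Rightarrow> real) \<Rightarrow> 'a \<Rightarrow> 'a \<Rightarrow> 'a" where
  "levi_civita br B u v =
     (THE z. \<forall>w. 2 * B z w = B (br u v) w + B (br w u) v + B (br w v) u)"

(* Sign convention: R_uv = nabla_[u,v] - [nabla_u, nabla_v]. *)
definition curvature ::
  "('a::real_vector \<Rightarrow> 'a \<Rightarrow> 'a) \<Rightarrow> ('a \<Rightarrow> 'a \<Rightarrow> real) \<Rightarrow> 'a \<Rightarrow> 'a \<Rightarrow> 'a \<Rightarrow> 'a" where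
  "curvature br B u v x =
     levi_civita br B (br u v) x -
     (levi_civita br B u (levi_civita br B v x) - levi_civita br B v (levi_civita br B u x))"

definition ricci ::
  "(real^'n \<Rightarrow> real^'n \<Rightarrow> real^'n) \<Rightarrow> (real^'n \<Rightarrow> real^'n \<Rightarrow> real) \<Rightarrow>
    real^'n \<Rightarrow> real^'n \<Rightarrow> real" where
  "ricci br B u v = trace (matrix (\<lambda>w. curvature br B u w v))"

definition ricci_operator ::
  "(real^'n \<Rightarrow> real^'n \<Rightarrow> real^'n) \<Rightarrow> (real^'n \<Rightarrow> real^'n \<Rightarrow> real) \<Rightarrow>
    real^'n \<Rightarrow> real^'n" where
  "ricci_operator br B u = (THE z. \<forall>v. B z v = ricci br B u v)"

definition algebraic_ricci_soliton ::
  "(real^'n \<Rightarrow> real^'n \<Rightarrow> real^'n) \<Rightarrow> (real^'n \<Rightarrow> real^'n \<Rightarrow> real) \<Rightarrow> bool" where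
  "algebraic_ricci_soliton br B \<longleftrightarrow>
     (\<exists>\<eta> D. derivation br D \<and> (\<forall>x. ricci_operator br B x = \<eta> *\<^sub>R x + D x))"


subsection \<open>The definite descriptions are well defined\<close>

lemma pseudo_inner_represents:
  fixes B :: "real^'n \<Rightarrow> real^'n \<Rightarrow> real"
  assumes B: "pseudo_inner B" and f: "linear f"
  shows "\<exists>!z. \<forall>w. B z w = f w"
proof -
  have bil: "bilinear B" and nd: "\<And>x. (\<forall>y. B x y = 0) \<Longrightarrow> x = 0"
    using B by (auto simp: pseudo_inner_def)
  have linl: "linear (\<lambda>x. B x y)" and linr: "linear (B x)" for x y
    using bil by (auto simp: bilinear_def)
  have ext: "g = h" if "linear g" "linear h" "\<And>i. g (axis i 1) = h (axis i 1)"
    for g h :: "real^'n \<Rightarrow> real"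
  proof (rule linear_eq_stdbasis[OF that(1,2)])
    fix b :: "real^'n" assume "b \<in> Basis"
    then show "g b = h b" using that(3) by (auto simp: Basis_vec_def)
  qed
  define L where "L z = (\<chi> i. B z (axis i 1))" for z
  have linL: "linear L"
    by (rule linearI)
       (auto simp: L_def vec_eq_iff bilinear_ladd[OF bil] bilinear_lmul[OF bil])
  have "z = 0" if "L z = 0" for z
  proof -
    have "B z = (\<lambda>_. 0)"
      using that by (intro ext linr) (auto simp: L_def vec_eq_iff linear_iff)
    then show "z = 0" using nd by simp
  qed
  then have "inj L" using linL linear_injective_0 by blast
  then have "surj L" using linL linear_injective_imp_surjective by blast
  then obtain z where z: "L z = (\<chi> i. f (axis i 1))" by (metis surj_def)
  have "B z = f" using z by (intro ext linr f) (auto simp: L_def vec_eq_iff)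
  moreover have "z' = z" if "\<forall>w. B z' w = f w" for z'
  proof -
    have "L z' = L z" using that z by (simp add: L_def)
    then show ?thesis using \<open>inj L\<close> by (simp add: inj_eq)
  qed
  ultimately show ?thesis by auto
qed

lemma levi_civita:
  fixes B :: "real^'n \<Rightarrow> real^'n \<Rightarrow> real"
  assumes B: "pseudo_inner B" and br: "lie_bracket br"
  shows "2 * B (levi_civita br B u v) w = B (br u v) w + B (br w u) v + B (br w v) u"
proof -
  have bil: "bilinear B" "bilinear br"
    using B br by (auto simp: pseudo_inner_def lie_bracket_def)
  have "linear (\<lambda>w. (B (br u v) w + B (br w u) v + B (br w v) u) / 2)"
    by (rule linearI)
       (auto simp: bil[THEN bilinear_ladd] bil[THEN bilinear_radd]
         bil[THEN bilinear_lmul] bil[THEN bilinear_rmul] field_simps)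
  from pseudo_inner_represents[OF B this]
  have "\<exists>!z. \<forall>w. 2 * B z w = B (br u v) w + B (br w u) v + B (br w v) u"
    by (simp add: field_simps)
  from theI'[OF this] show ?thesis by (simp add: levi_civita_def)
qed

lemma levi_civita_unique:
  fixes B :: "real^'n \<Rightarrow> real^'n \<Rightarrow> real"
  assumes B: "pseudo_inner B" and br: "lie_bracket br"
    and z: "\<And>w. 2 * B z w = B (br u v) w + B (br w u) v + B (br w v) u"
  shows "z = levi_civita br B u v"
proof -
  have "B (z - levi_civita br B u v) w = 0" for w
    using z[of w] levi_civita[OF B br, of u v w] bilinear_lsub[of B] B[unfolded pseudo_inner_def]
    by simp
  then have "z - levi_civita br B u v = 0"
    using B unfolding pseudo_inner_def by blast
  then show ?thesis by simp
qed

lemma bilinear_levi_civita: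
  fixes B :: "real^'n \<Rightarrow> real^'n \<Rightarrow> real"
  assumes B: "pseudo_inner B" and br: "lie_bracket br"
  shows "bilinear (levi_civita br B)"
proof -
  have bil: "bilinear B" "bilinear br"
    using B br by (auto simp: pseudo_inner_def lie_bracket_def)
  note simps = bil[THEN bilinear_ladd] bil[THEN bilinear_radd]
         bil[THEN bilinear_lmul] bil[THEN bilinear_rmul]
  have lc: "B (levi_civita br B u v) w = (B (br u v) w + B (br w u) v + B (br w v) u) / 2"
    for u v w using levi_civita[OF B br, of u v w] by simp
  show ?thesis
    unfolding bilinear_def
    by (intro conjI allI linearI levi_civita_unique[OF B br, symmetric])
       (auto simp: simps lc field_simps)
qed

lemma ricci_operator:
  fixes B :: "real^'n \<Rightarrow> real^'n \<Rightarrow> real"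
  assumes B: "pseudo_inner B" and br: "lie_bracket br"
  shows "B (ricci_operator br B u) v = ricci br B u v"
proof -
  note lc = bilinear_levi_civita[OF B br]
  have "linear (ricci br B u)"
    by (rule linearI)
       (auto simp: ricci_def curvature_def trace_def matrix_def
         bilinear_radd[OF lc] bilinear_rmul[OF lc]
         sum.distrib sum_subtractf sum_distrib_left algebra_simps)
  from theI'[OF pseudo_inner_represents[OF B this]]
  show ?thesis by (simp add: ricci_operator_def)
qed


subsection \<open>The Lie algebra\<close>

(* Realised on real^4, with e_i = axis i 1; the index 4 :: 4 is the same element as 0. *)
definition g350_g1 :: "real^4 \<Rightarrow> real^4 \<Rightarrow> real^4" where
  "g350_g1 x y =
     (x$2 * y$3 - x$3 * y$2) *\<^sub>R axis 1 1 + (x$3 * y$1 - x$1 * y$3) *\<^sub>R axis 2 1"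

lemma lie_bracket_g350_g1: "lie_bracket g350_g1"
  unfolding lie_bracket_def bilinear_def
  by (auto intro!: linearI simp: g350_g1_def vec_eq_iff forall_4 axis_def algebra_simps)

lemma g350_g1_table:
  shows "g350_g1 (axis 2 1) (axis 3 1) = axis 1 1"
    and "g350_g1 (axis 3 1) (axis 1 1) = axis 2 1"
    and "g350_g1 (axis 1 1) (axis 2 1) = 0"
    and "g350_g1 (axis 4 1) x = 0"
  by (auto simp: g350_g1_def vec_eq_iff forall_4 axis_def)

lemma vector_4:
  "(vector [a, b, c, d] :: 'a::zero^4) $ 1 = a"
  "(vector [a, b, c, d] :: 'a^4) $ 2 = b"
  "(vector [a, b, c, d] :: 'a^4) $ 3 = c"
  "(vector [a, b, c, d] :: 'a^4) $ 4 = d"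
  by (simp_all add: vector_def)

end

theory Submission
  imports Defs
begin

text \<open>No curvature is computed. The prescribed zeros and symmetries say, entry by entry, that
  R - R_33 I has the shape of D, so it remains to see that such a matrix is a derivation
  (\<open>derivation_g350_g1\<close>) and that the Ricci operator is multiplication by its matrix,
  i.e. is linear (\<open>linear_ricci_operator\<close>).\<close>

lemma ricci_linear_left:
  fixes B :: "real^'n \<Rightarrow> real^'n \<Rightarrow> real"
  assumes B: "pseudo_inner B" and br: "lie_bracket br"
  shows "linear (\<lambda>u. ricci br B u v)"
proof -
  note lc = bilinear_levi_civita[OF B br]
  have bil: "bilinear br"
    using br by (simp add: lie_bracket_def)
  show ?thesis
    by (rule linearI)
       (auto simp: ricci_def curvature_def trace_def matrix_def
         bilinear_ladd[OF lc] bilinear_lmul[OF lc] bilinear_radd[OF lc] bilinear_rmul[OF lc]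
         bilinear_ladd[OF bil] bilinear_lmul[OF bil]
         sum.distrib sum_subtractf sum_distrib_left algebra_simps)
qed

text \<open>The operator is given by a definite description, so linearity has to come from the form:
  \<open>ricci\<close> is linear in its first argument, and nondegeneracy of \<open>B\<close>
  carries this over to the representing vector.\<close>

lemma linear_ricci_operator:
  fixes B :: "real^'n \<Rightarrow> real^'n \<Rightarrow> real"
  assumes B: "pseudo_inner B" and br: "lie_bracket br"
  shows "linear (ricci_operator br B)"
proof -
  have bil: "bilinear B" and nd: "\<And>x. (\<And>y. B x y = 0) \<Longrightarrow> x = 0"
    using B by (auto simp: pseudo_inner_def)
  have eqI: "x = y" if "\<And>w. B x w = B y w" for x y
    using nd[of "x - y"] that by (simp add: bilinear_lsub[OF bil])
  show ?thesis
    by (intro linearI eqI)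
       (simp_all add: bilinear_ladd[OF bil] bilinear_lmul[OF bil] ricci_operator[OF B br]
         linear_add[OF ricci_linear_left[OF B br]] linear_cmul[OF ricci_linear_left[OF B br]])
qed

text \<open>The algebra is the abelian plane <e_1, e_2>, rotated by ad e_3, plus the central line of
  e_4. The block with rows (a, b), (-b, a) commutes with that rotation; the image of e_3 has no e_3
  component, so it commutes with the plane; and e_4 stays in the centre.\<close>

lemma derivation_g350_g1:
  fixes a b c d p q :: real
  shows "derivation g350_g1 ((*v) (vector
    [vector [a, b, c, 0],
     vector [- b, a, d, 0],
     vector [0, 0, 0, 0],
     vector [0, 0, p, q]] :: real^4^4))"
  unfolding derivation_def
  by (simp add: matrix_vector_mul_linear vec_eq_iff forall_4 matrix_vector_mult_def sum_4
      vector_4 g350_g1_def axis_def algebra_simps)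

theorem theorem3p8:
  fixes B :: "real^4 \<Rightarrow> real^4 \<Rightarrow> real" and R :: "real^4^4"
  assumes "pseudo_inner B"
    and "R = matrix (ricci_operator g350_g1 B)"
    and "R$3$1 = 0" "R$4$1 = 0" "R$3$2 = 0" "R$4$2 = 0"
    and "R$1$4 = 0" "R$2$4 = 0" "R$3$4 = 0"
    and "R$2$1 = - R$1$2"
    and "R$2$2 = R$1$1"
  shows "algebraic_ricci_soliton g350_g1 B \<and>
    (let D = vector
       [vector [R$1$1 - R$3$3, R$1$2, R$1$3, 0],
        vector [- R$1$2, R$1$1 - R$3$3, R$2$3, 0],
        vector [0, 0, 0, 0],
        vector [0, 0, R$4$3, R$4$4 - R$3$3]] :: real^4^4
     in derivation g350_g1 ((*v) D) \<and>
        (\<forall>x. ricci_operator g350_g1 B x = R$3$3 *\<^sub>R x + D *v x))"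
proof -
  define D :: "real^4^4" where "D = vector
       [vector [R$1$1 - R$3$3, R$1$2, R$1$3, 0],
        vector [- R$1$2, R$1$1 - R$3$3, R$2$3, 0],
        vector [0, 0, 0, 0],
        vector [0, 0, R$4$3, R$4$4 - R$3$3]]"
  have D: "derivation g350_g1 ((*v) D)"
    unfolding D_def by (rule derivation_g350_g1)
  have Ric: "ricci_operator g350_g1 B x = R$3$3 *\<^sub>R x + D *v x" for x
  proof -
    have "ricci_operator g350_g1 B x = R *v x"
      using matrix_vector_mul(2)[OF linear_ricci_operator[OF assms(1) lie_bracket_g350_g1]] assms(2)
      by metis
    also have "\<dots> = R$3$3 *\<^sub>R x + D *v x"
      \<comment> \<open>Subtracting R_33 on the diagonal is what clears the third row: derivations
        of the above shape send nothing to the e_3 direction.\<close>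
      using assms(3-)
      by (simp add: D_def vec_eq_iff forall_4 matrix_vector_mult_def sum_4 vector_4 algebra_simps)
    finally show ?thesis .
  qed
  then have "algebraic_ricci_soliton g350_g1 B"
    using D unfolding algebraic_ricci_soliton_def by blast
  then show ?thesis
    using D Ric unfolding D_def Let_def by blast
qed

end
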